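(* Let $k\ge 3$ and $\ell \geq 1$ be integers, let $v = k^2-k+2\ell$, and suppose there is a $(v,k)$-modular Golomb ruler. Then the following hold. 1. If $v \equiv 2 \pmod 4$, then $k - 2\ell + 2 + 4i$ is a perfect square for some integer $i \in \{0, \dots , \ell - 1\}$. 2. If $v \equiv 0 \pmod 4$, then $k - 2\ell + 4i$ is a perfect square for some integer $i \in \{0, \dots , \ell - 1\}$.
   Context: For an integer $k\ge 3$ and a positive integer $v$, a $(v,k)$-modular Golomb ruler ($(v,k)$-MGR) is a set of $k$ distinct integers $0 \leq x_1 < x_2 < \cdots < x_k \leq v-1$ such that all the differences $x_j - x_i \bmod v$ (over ordered pairs $(i,j)$ with $i \neq j$) are distinct elements of $\mathbb{Z}_v$. A perfect square is the square of an integer ($0$ allowed). *)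

theory Defs
  imports "HOL-Number_Theory.Cong" "HOL-Computational_Algebra.Nth_Powers"
begin

(* The increasing sequence x_1 < ... < x_k is given by the set X of its members, and
   elements of Z_v by their representatives in {0..<v}.  Distinctness of the differences
   is injectivity on ordered pairs of distinct members; the differences need not
   exhaust the nonzero residues. *)
definition modular_golomb_ruler :: "nat \<Rightarrow> nat \<Rightarrow> int set \<Rightarrow> bool" where
  "modular_golomb_ruler v k X \<longleftrightarrow>
     3 \<le> k \<and> 0 < v \<and> X \<subseteq> {0..int v - 1} \<and> card X = k \<and>
     inj_on (\<lambda>(x, y). (y - x) mod int v) {(x, y). x \<in> X \<and> y \<in> X \<and> x \<noteq> y}"

end

theory Submission
  imports Defs
begin

text \<open>
  The argument counts differences by parity.  Since \<open>v = 2 * h\<close> is even, reduction mod \<open>v\<close>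
  preserves parity.  Let the ruler have \<open>a\<close> even and \<open>b\<close> odd members.  Exactly \<open>2 * a * b\<close> of
  its \<open>k\<^sup>2 - k\<close> differences are odd, and they are distinct, so with \<open>h\<close> odd residues available
  the number of odd residues that are not differences is \<open>m = h - 2 * a * b \<ge> 0\<close>.  The remaining
  differences are distinct among the \<open>h - 1\<close> nonzero even residues, which forces \<open>m \<le> 2 * l - 1\<close>.
  Both counts are in \<open>modular_golomb_ruler_parity_bounds\<close>.  Now
  \<open>(a - b)\<^sup>2 = k\<^sup>2 - 4 * a * b = k + v - 2 * l - 4 * a * b = k - 2 * l + 2 * m\<close>
  and \<open>m\<close> has the parity of \<open>h\<close>; writing \<open>m = 2 * i + 1\<close> or \<open>m = 2 * i\<close> gives the two cases.
\<close>

lemma card_odd_residues: "card {d \<in> {0..<2 * int h}. odd d} = h"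
proof -
  have "{d \<in> {0..<2 * int h}. odd d} = (\<lambda>t. 2 * t + 1) ` {0..<int h}"
    by (auto elim!: oddE)
  then show ?thesis
    by (simp add: card_image inj_on_def)
qed

lemma card_nonzero_even_residues: "card {d \<in> {1..<2 * int h}. even d} = h - 1"
proof -
  have "{d \<in> {1..<2 * int h}. even d} = (\<lambda>t. 2 * t) ` {1..<int h}"
    by (auto elim!: evenE)
  then show ?thesis
    by (simp add: card_image inj_on_def)
qed

lemma card_ordered_pairs_distinct:
  assumes "finite X"
  shows "card {(x, y). x \<in> X \<and> y \<in> X \<and> x \<noteq> y} = card X * (card X - 1)"
proof -
  have "{(x, y). x \<in> X \<and> y \<in> X \<and> x \<noteq> y} = (SIGMA x:X. X - {x})"
    by auto
  then show ?thesis
    using assms by simp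
qed

lemma card_ordered_pairs_odd_difference:
  fixes X :: "int set"
  assumes "finite X"
  shows "card {(x, y). x \<in> X \<and> y \<in> X \<and> odd (y - x)} =
    2 * card {x \<in> X. even x} * card {x \<in> X. odd x}"
proof -
  let ?A = "{x \<in> X. even x}" and ?B = "{x \<in> X. odd x}"
  have "{(x, y). x \<in> X \<and> y \<in> X \<and> odd (y - x)} = ?A \<times> ?B \<union> ?B \<times> ?A"
    by auto
  moreover have "card (?A \<times> ?B \<union> ?B \<times> ?A) = card (?A \<times> ?B) + card (?B \<times> ?A)"
    using assms by (intro card_Un_disjoint) auto
  ultimately show ?thesis
    by (simp add: card_cartesian_product)
qed

text \<open>
  The two counting bounds for a ruler of even modulus.  The left-hand side of the second one is
  the number of even differences; its subtraction does not truncate, because the \<open>2 * a * b\<close> odd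
  differences are among all the \<open>k * (k - 1)\<close>.
\<close>

lemma modular_golomb_ruler_parity_bounds:
  assumes ruler: "modular_golomb_ruler (2 * h) k X"
  defines "a \<equiv> card {x \<in> X. even x}" and "b \<equiv> card {x \<in> X. odd x}"
  shows "2 * a * b \<le> h" and "k * (k - 1) - 2 * a * b \<le> h - 1" and "a + b = k"
proof -
  let ?f = "\<lambda>(x, y). (y - x) mod (2 * int h)"
  let ?P = "{(x, y). x \<in> X \<and> y \<in> X \<and> x \<noteq> y}"
  let ?O = "{(x, y). x \<in> X \<and> y \<in> X \<and> odd (y - x)}"
  have h: "0 < h" and X: "X \<subseteq> {0..<2 * int h}" and k: "card X = k" and inj: "inj_on ?f ?P"
    using ruler by (auto simp: modular_golomb_ruler_def)
  have fin: "finite X"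
    using X by (rule finite_subset) simp
  have finP: "finite ?P"
    by (rule finite_subset[of _ "X \<times> X"]) (use fin in auto)
  have OP: "?O \<subseteq> ?P"
    by auto
  have cardO: "card ?O = 2 * a * b"
    using card_ordered_pairs_odd_difference[OF fin] by (simp add: a_def b_def)
  have fin_residues: "finite {d \<in> {i..<j}. Q d}" for i j :: int and Q
    by (rule finite_subset[of _ "{i..<j}"]) auto
  have parity: "even (d mod (2 * int h)) \<longleftrightarrow> even d" for d
    by (simp add: dvd_mod_iff)
  have "?f ` ?O \<subseteq> {d \<in> {0..<2 * int h}. odd d}"
    using h by (auto simp: parity)
  then have "card ?O \<le> card {d \<in> {0..<2 * int h}. odd d}"
    by (rule card_inj_on_le[OF inj_on_subset[OF inj OP] _ fin_residues])
  then show "2 * a * b \<le> h"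
    by (simp only: card_odd_residues cardO)
  have nonzero: "(y - x) mod (2 * int h) \<noteq> 0" if "x \<in> X" "y \<in> X" "x \<noteq> y" for x y
  proof
    assume "(y - x) mod (2 * int h) = 0"
    then have "y mod (2 * int h) = x mod (2 * int h)"
      by (simp add: mod_eq_dvd_iff mod_eq_0_iff_dvd)
    then show False
      using that X by (auto simp: subset_iff)
  qed
  have even_residue: "(y - x) mod (2 * int h) \<in> {d \<in> {1..<2 * int h}. even d}"
    if "x \<in> X" "y \<in> X" "x \<noteq> y" "even (y - x)" for x y
  proof -
    have "0 \<le> (y - x) mod (2 * int h)" and "(y - x) mod (2 * int h) < 2 * int h"
      using h by simp_all
    moreover have "even ((y - x) mod (2 * int h))"
      unfolding parity by (rule that(4))
    ultimately show ?thesis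
      using nonzero[OF that(1-3)] unfolding mem_Collect_eq atLeastLessThan_iff by linarith
  qed
  have "?f ` (?P - ?O) \<subseteq> {d \<in> {1..<2 * int h}. even d}"
  proof (rule image_subsetI)
    fix p assume "p \<in> ?P - ?O"
    then obtain x y where p: "p = (x, y)" and xy: "x \<in> X" "y \<in> X" "x \<noteq> y" "even (y - x)"
      by auto
    show "?f p \<in> {d \<in> {1..<2 * int h}. even d}"
      unfolding p prod.case using xy by (rule even_residue)
  qed
  then have "card (?P - ?O) \<le> card {d \<in> {1..<2 * int h}. even d}"
    by (rule card_inj_on_le[OF inj_on_subset[OF inj Diff_subset] _ fin_residues])
  moreover have "card (?P - ?O) = k * (k - 1) - 2 * a * b"
    using card_Diff_subset[OF finite_subset[OF OP finP] OP] cardO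
      card_ordered_pairs_distinct[OF fin] k by simp
  ultimately show "k * (k - 1) - 2 * a * b \<le> h - 1"
    by (simp only: card_nonzero_even_residues)
  have "X = {x \<in> X. even x} \<union> {x \<in> X. odd x}"
    by auto
  then have "card X = a + b"
    unfolding a_def b_def using fin by (subst card_Un_disjoint[symmetric]) auto
  then show "a + b = k"
    using k by simp
qed

theorem theorem3p6:
  fixes k l v :: nat
  assumes "k \<ge> 3" and "l \<ge> 1"
    and "int v = (int k)^2 - int k + 2 * int l"
    and "\<exists>X. modular_golomb_ruler v k X"
  shows "([v = 2] (mod 4) \<longrightarrow>
            (\<exists>i\<in>{0..int l - 1}. is_square (int k - 2 * int l + 2 + 4 * i))) \<and>
         ([v = 0] (mod 4) \<longrightarrow>
            (\<exists>i\<in>{0..int l - 1}. is_square (int k - 2 * int l + 4 * i)))"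
proof -
  obtain X where X: "modular_golomb_ruler v k X"
    using assms(4) by blast
  have "even (int v)"
    unfolding assms(3) by simp
  then obtain h where v: "v = 2 * h"
    by auto
  define a b where "a = card {x \<in> X. even x}" and "b = card {x \<in> X. odd x}"
  have odd_bound: "2 * a * b \<le> h" and even_bound: "k * (k - 1) - 2 * a * b \<le> h - 1"
    and ab: "a + b = k"
    using modular_golomb_ruler_parity_bounds[of h k X] X by (simp_all add: v a_def b_def)
  define m where "m = int h - 2 * (int a * int b)"
  have h: "2 * int h = (int k)\<^sup>2 - int k + 2 * int l"
    using assms(3) v by simp
  have "int (2 * a * b) \<le> int h"
    using odd_bound by (simp only: of_nat_le_iff)
  then have m0: "0 \<le> m"
    by (simp add: m_def)
  have "0 < h"
    using X by (simp add: modular_golomb_ruler_def v)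
  have "int (k * (k - 1)) = (int k)\<^sup>2 - int k"
    using assms(1) by (simp add: algebra_simps power2_eq_square)
  moreover have "int (k * (k - 1)) \<le> int (2 * a * b) + int h - 1"
    using even_bound \<open>0 < h\<close> by linarith
  ultimately have m1: "m \<le> 2 * int l - 1"
    using h by (simp add: m_def)
  have "(int a - int b)\<^sup>2 = (int k)\<^sup>2 - 4 * (int a * int b)"
    by (simp add: ab[symmetric] power2_eq_square algebra_simps)
  also have "\<dots> = int k - 2 * int l + 2 * m"
    using h by (simp add: m_def)
  finally have square: "is_square (int k - 2 * int l + 2 * m)"
    by (metis is_nth_powerI)
  have parity: "even m \<longleftrightarrow> even h"
    by (simp add: m_def)
  show ?thesis
  proof (intro conjI impI)
    assume "[v = 2] (mod 4)"
    then have "odd m"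
      unfolding parity v cong_def by presburger
    then obtain i where i: "m = 2 * i + 1"
      by (elim oddE)
    show "\<exists>i\<in>{0..int l - 1}. is_square (int k - 2 * int l + 2 + 4 * i)"
      using square m0 m1 by (intro bexI[of _ i]) (auto simp: i algebra_simps)
  next
    assume "[v = 0] (mod 4)"
    then have "even m"
      unfolding parity v cong_def by presburger
    then obtain i where i: "m = 2 * i"
      by (elim evenE)
    show "\<exists>i\<in>{0..int l - 1}. is_square (int k - 2 * int l + 4 * i)"
      using square m0 m1 by (intro bexI[of _ i]) (auto simp: i algebra_simps)
  qed
qed

end
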